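(* Let $\mathcal{H}_A,\mathcal{H}_B$ be finite-dimensional complex Hilbert spaces. Let $\rho_1,\rho_2\in\mathcal{D}(\mathcal{H}_A\otimes\mathcal{H}_B)$ with $\frac12\|\rho_1-\rho_2\|_1=\varepsilon$ for some $\varepsilon\in[0,1]$. Let $\rho_+,\rho_-\in\mathcal{D}(\mathcal{H}_A\otimes\mathcal{H}_B)$ with $\rho_+\perp\rho_-$ be the normalized Jordan-Hahn decomposition of $\rho_1-\rho_2$, i.e. $\rho_1-\rho_2=\varepsilon\rho_+-\varepsilon\rho_-$. Assume further that the operator $$K:=\rho_1-\varepsilon\rho_+=\rho_2-\varepsilon\rho_-$$ is positive semi-definite. Then $$S(A|B)_{\rho_1}-S(A|B)_{\rho_2}\le \varepsilon S(A|B)_{\rho_+}-\varepsilon S(A|B)_{\rho_-}+h(\varepsilon).$$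
   Context: $\mathcal{D}(\mathcal{H})$ denotes the set of quantum states (density matrices) on $\mathcal{H}$: positive semi-definite operators of unit trace. $\|\cdot\|_1$ is the trace norm. $\log$ is the natural logarithm and $0\log 0=0$. The von Neumann entropy is $S(\rho)=-\mathrm{Tr}(\rho\log\rho)$, and $h(\varepsilon)=-\varepsilon\log\varepsilon-(1-\varepsilon)\log(1-\varepsilon)$ is the binary entropy. For $\rho\in\mathcal{D}(\mathcal{H}_A\otimes\mathcal{H}_B)$, the conditional entropy is $S(A|B)_\rho=S(\rho)-S(\rho_B)$ with $\rho_B=\mathrm{Tr}_A\rho$ (partial trace over $A$). $\rho_+\perp\rho_-$ means that the operators have orthogonal supports. The Jordan-Hahn decomposition writes $\rho_1-\rho_2=\Delta_+-\Delta_-$ with $\Delta_\pm\ge 0$ of orthogonal supports; then $\Delta_\pm=\varepsilon\rho_\pm$ if $\varepsilon>0$, and if $\varepsilon=0$ the states $\rho_\pm$ are an arbitrary choice of states with orthogonal supports. *)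

theory Defs
  imports "HOL-Analysis.Analysis"
begin

text \<open>
  Operators on a Hilbert space with an orthonormal basis indexed by a finite type \<open>'n\<close> are
  matrices of type \<open>complex^'n^'n\<close>. The tensor product of the spaces with bases indexed by
  \<open>'a\<close> and \<open>'b\<close> has the product basis, indexed by \<open>'a \<times> 'b\<close>.
\<close>

definition cdot :: "complex^'n \<Rightarrow> complex^'n \<Rightarrow> complex" where
  "cdot x y = (\<Sum>i\<in>UNIV. cnj (x $ i) * y $ i)"

definition adj :: "complex^'n^'m \<Rightarrow> complex^'m^'n" where
  "adj A = (\<chi> i j. cnj (A $ j $ i))"

definition unitary :: "complex^'n^'n \<Rightarrow> bool" where
  "unitary U \<longleftrightarrow> adj U ** U = mat 1 \<and> U ** adj U = mat 1"

definition diag :: "('n \<Rightarrow> real) \<Rightarrow> complex^'n^'n" where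
  "diag d = (\<chi> i j. if i = j then complex_of_real (d i) else 0)"

text \<open>Over the complex numbers this condition implies that \<open>A\<close> is Hermitian.\<close>

definition psd :: "complex^'n^'n \<Rightarrow> bool" where
  "psd A \<longleftrightarrow> (\<forall>x. cdot x (A *v x) \<in> \<real>\<^sub>\<ge>\<^sub>0)"

definition density_matrix :: "complex^'n^'n \<Rightarrow> bool" where
  "density_matrix \<rho> \<longleftrightarrow> psd \<rho> \<and> trace \<rho> = 1"

text \<open>The support of an operator is the orthogonal complement of its kernel.\<close>

definition supp :: "complex^'n^'n \<Rightarrow> (complex^'n) set" where
  "supp A = {v. \<forall>w. A *v w = 0 \<longrightarrow> cdot w v = 0}"

definition orthogonal_supports :: "complex^'n^'n \<Rightarrow> complex^'n^'n \<Rightarrow> bool" where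
  "orthogonal_supports A B \<longleftrightarrow> (\<forall>v\<in>supp A. \<forall>w\<in>supp B. cdot v w = 0)"

text \<open>
  Functional calculus for Hermitian matrices: \<open>f (U diag(d) U\<^sup>*) = U diag(f \<circ> d) U\<^sup>*\<close>.
  Every Hermitian matrix has such a diagonalization by the spectral theorem, and the result
  does not depend on the one chosen (\<open>hfun_diagonalization\<close> below).
\<close>

definition hfun :: "(real \<Rightarrow> real) \<Rightarrow> complex^'n^'n \<Rightarrow> complex^'n^'n" where
  "hfun f A = (THE B. \<exists>U d. unitary U \<and> A = U ** diag d ** adj U
                               \<and> B = U ** diag (\<lambda>i. f (d i)) ** adj U)"

lemma diag_mult_left: "(diag d ** A) $ i $ j = complex_of_real (d i) * A $ i $ j"
  by (simp add: matrix_matrix_mult_def diag_def if_distrib[of "\<lambda>x. x * _"] cong: if_cong)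

lemma diag_mult_right: "(A ** diag d) $ i $ j = A $ i $ j * complex_of_real (d j)"
  by (simp add: matrix_matrix_mult_def diag_def if_distrib[of "\<lambda>x. _ * x"] cong: if_cong)

lemma diagonalization_unique:
  assumes U: "unitary U" and V: "unitary V"
    and eq: "U ** diag d ** adj U = V ** diag e ** adj V"
  shows "U ** diag (\<lambda>i. f (d i)) ** adj U = V ** diag (\<lambda>i. f (e i)) ** adj V"
proof -
  define W where "W = adj V ** U"
  have UU: "adj U ** U = mat 1" "U ** adj U = mat 1"
    and VV: "adj V ** V = mat 1" "V ** adj V = mat 1"
    using U V by (auto simp: unitary_def)
  have "W ** diag d = adj V ** (U ** diag d ** adj U) ** U"
    unfolding W_def by (metis UU(1) matrix_mul_assoc matrix_mul_rid)
  also have "\<dots> = diag e ** W"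
    unfolding W_def eq by (metis VV(1) matrix_mul_assoc matrix_mul_lid)
  finally have "W ** diag d = diag e ** W" .
  then have ent: "W $ i $ j * complex_of_real (d j) = complex_of_real (e i) * W $ i $ j" for i j
    by (metis diag_mult_left diag_mult_right)
  have "W ** diag (\<lambda>i. f (d i)) = diag (\<lambda>i. f (e i)) ** W"
    using ent by (fastforce simp: vec_eq_iff diag_mult_left diag_mult_right)
  then have "V ** (W ** diag (\<lambda>i. f (d i))) ** adj U = V ** (diag (\<lambda>i. f (e i)) ** W) ** adj U"
    by simp
  moreover have "V ** (W ** diag (\<lambda>i. f (d i))) ** adj U = U ** diag (\<lambda>i. f (d i)) ** adj U"
    unfolding W_def by (metis VV(2) matrix_mul_assoc matrix_mul_lid)
  moreover have "V ** (diag (\<lambda>i. f (e i)) ** W) ** adj U = V ** diag (\<lambda>i. f (e i)) ** adj V"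
    unfolding W_def by (metis UU(2) matrix_mul_assoc matrix_mul_rid)
  ultimately show ?thesis by simp
qed

lemma hfun_diagonalization:
  assumes "unitary U"
  shows "hfun f (U ** diag d ** adj U) = U ** diag (\<lambda>i. f (d i)) ** adj U"
  unfolding hfun_def
proof (rule the_equality)
  show "\<exists>U' d'. unitary U' \<and> U ** diag d ** adj U = U' ** diag d' ** adj U'
      \<and> U ** diag (\<lambda>i. f (d i)) ** adj U = U' ** diag (\<lambda>i. f (d' i)) ** adj U'"
    using assms by blast
qed (use diagonalization_unique[OF assms] in metis)

definition trace_norm :: "complex^'n^'n \<Rightarrow> real" where
  "trace_norm A = Re (trace (hfun sqrt (adj A ** A)))"

text \<open>
  The value of \<open>ln\<close> at the eigenvalue 0 is irrelevant, because it is multiplied by that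
  eigenvalue; this is the convention \<open>0 log 0 = 0\<close>.
\<close>

definition entropy :: "complex^'n^'n \<Rightarrow> real" where
  "entropy \<rho> = - Re (trace (\<rho> ** hfun ln \<rho>))"

definition binary_entropy :: "real \<Rightarrow> real" where
  "binary_entropy \<epsilon> = - \<epsilon> * ln \<epsilon> - (1 - \<epsilon>) * ln (1 - \<epsilon>)"

definition partial_trace_A :: "complex^('a::finite \<times> 'b::finite)^('a \<times> 'b) \<Rightarrow> complex^'b^'b" where
  "partial_trace_A M = (\<chi> i j. \<Sum>k\<in>UNIV. M $ (k, i) $ (k, j))"

definition cond_entropy :: "complex^('a::finite \<times> 'b::finite)^('a \<times> 'b) \<Rightarrow> real" where
  "cond_entropy \<rho> = entropy \<rho> - entropy (partial_trace_A \<rho>)"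

end

theory Submission imports Defs begin

text \<open>
  All quantities are extended to unnormalized positive matrices. With \<open>P = \<epsilon> \<rho>\<^sub>p\<close> and
  \<open>M = \<epsilon> \<rho>\<^sub>m\<close> we have \<open>\<rho>\<^sub>1 = K + P\<close> and \<open>\<rho>\<^sub>2 = K + M\<close>. The entropy is subadditive,
  \<open>S(K + P) \<le> S(K) + S(P)\<close>; its concavity on the marginals costs \<open>h(\<epsilon>)\<close>; and the conditional
  entropy, which is homogeneous, is superadditive on \<open>K + M\<close> (strong subadditivity).

  All three are instances of \<open>D(\<rho> + \<rho>' \<parallel> \<sigma> + \<sigma>') \<le> D(\<rho> \<parallel> \<sigma>) + D(\<rho>' \<parallel> \<sigma>')\<close>: the first with
  \<open>D(X \<parallel> X + Y) \<le> D(X \<parallel> X) + D(0 \<parallel> Y) = 0\<close>, the second with \<open>\<sigma> = (Tr \<rho>) 1\<close>, the third with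
  \<open>\<sigma> = 1 \<otimes> \<rho>\<^sub>B\<close>. The subadditivity of \<open>D\<close> follows from the representation of \<open>D(\<rho> \<parallel> \<sigma>)\<close> as a
  regularized integral over \<open>t \<ge> 0\<close> of suprema of forms that are linear in \<open>(\<rho>, \<sigma>)\<close>.
\<close>

section \<open>Spectral decomposition of positive semidefinite matrices\<close>

lemma cdot_add_left: "cdot (x + y) z = cdot x z + cdot y z"
  by (simp add: cdot_def algebra_simps sum.distrib)

lemma cdot_add_right: "cdot x (y + z) = cdot x y + cdot x z"
  by (simp add: cdot_def algebra_simps sum.distrib)

lemma cdot_diff_right: "cdot x (y - z) = cdot x y - cdot x z"
  by (simp add: cdot_def algebra_simps sum_subtractf)

lemma cdot_scale_left: "cdot (c *s x) y = cnj c * cdot x y"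
  by (simp add: cdot_def algebra_simps sum_distrib_left)

lemma cdot_scale_right: "cdot x (c *s y) = c * cdot x y"
  by (simp add: cdot_def algebra_simps sum_distrib_left)

lemmas cdot_simps = cdot_add_left cdot_add_right cdot_diff_right cdot_scale_left cdot_scale_right

lemma cdot_cnj: "cnj (cdot x y) = cdot y x"
  by (simp add: cdot_def mult.commute)

lemma cdot_self: "cdot x x = complex_of_real ((norm x)\<^sup>2)"
proof -
  have "cdot x x = (\<Sum>i\<in>UNIV. complex_of_real ((cmod (x $ i))\<^sup>2))"
    unfolding cdot_def by (metis complex_norm_square mult.commute)
  also have "\<dots> = complex_of_real ((norm x)\<^sup>2)"
    by (simp add: norm_vec_def L2_set_def sum_nonneg)
  finally show ?thesis .
qed

lemma continuous_on_cdot [continuous_intros]: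
  assumes "continuous_on S f" "continuous_on S g"
  shows "continuous_on S (\<lambda>x. cdot (f x) (g x))"
  unfolding cdot_def by (intro continuous_intros assms)

lemma cdot_adj: "cdot x (A *v y) = cdot (adj A *v x) y"
  by (simp add: cdot_def adj_def matrix_vector_mult_def sum_distrib_left sum_distrib_right
      algebra_simps) (rule sum.swap)

lemma adj_mult: "adj (A ** B) = adj B ** adj A"
  by (simp add: adj_def matrix_matrix_mult_def vec_eq_iff mult.commute)

lemma adj_adj [simp]: "adj (adj A) = A"
  by (simp add: adj_def vec_eq_iff)

lemma adj_diag [simp]: "adj (diag d) = diag d"
  by (simp add: adj_def diag_def vec_eq_iff)

lemma adj_mat_1 [simp]: "adj (mat 1) = mat 1"
  by (auto simp: adj_def mat_def vec_eq_iff)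

lemma psd_iff: "psd A \<longleftrightarrow> (\<forall>x. Im (cdot x (A *v x)) = 0 \<and> 0 \<le> Re (cdot x (A *v x)))"
  by (auto simp: psd_def complex_nonneg_Reals_iff)

text \<open>Polarization: since the form is real at every vector, its expansions at
  \<open>x + y\<close> and \<open>x + \<i> *s y\<close> force the imaginary parts of
  \<open>cdot x (A *v y)\<close> and \<open>cdot y (A *v x)\<close> to be opposite and the real
  parts to agree.\<close>

lemma psd_hermitian:
  assumes "psd A"
  shows "cdot x (A *v y) = cdot (A *v x) y"
proof -
  have im: "Im (cdot z (A *v z)) = 0" for z
    using assms by (simp add: psd_iff)
  have "Im (cdot x (A *v y)) + Im (cdot y (A *v x)) = 0"
    using im[of "x + y"] im[of x] im[of y]
    by (simp add: matrix_vector_right_distrib cdot_simps)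
  moreover have "Re (cdot x (A *v y)) - Re (cdot y (A *v x)) = 0"
    using im[of "x + \<i> *s y"] im[of x] im[of y]
    by (simp add: matrix_vector_right_distrib vec.scale cdot_simps)
  ultimately have "cdot x (A *v y) = cnj (cdot y (A *v x))"
    by (simp add: complex_eq_iff)
  then show ?thesis by (simp add: cdot_cnj)
qed

text \<open>Otherwise a small \<open>s\<close> of sign opposite to \<open>a\<close> lets the linear
  term dominate; \<open>s = - a / u\<close> gives a value of at most
  \<open>- a^2 / u\<close>.\<close>

lemma quadratic_nonneg_imp_linear_zero:
  fixes a b :: real
  assumes "\<And>s. 0 \<le> 2 * s * a + s\<^sup>2 * b"
  shows "a = 0"
proof (rule ccontr)
  assume "a \<noteq> 0"
  define u where "u = 1 + \<bar>b\<bar>"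
  define s where "s = - a / u"
  have u: "0 < u" "b \<le> u" by (auto simp: u_def)
  have "2 * s * a + s\<^sup>2 * b \<le> 2 * s * a + s\<^sup>2 * u"
    using u by (intro add_left_mono mult_left_mono) auto
  also have "\<dots> = - (a\<^sup>2 / u)"
    using u by (simp add: s_def field_simps power2_eq_square)
  also have "\<dots> < 0" using \<open>a \<noteq> 0\<close> u by simp
  finally show False using assms[of s] by simp
qed

text \<open>On the line through \<open>x\<close> in direction \<open>B *v x\<close> the form is
  minimal at \<open>x\<close>, so its first variation there, twice \<open>(norm (B *v x))^2\<close>,
  vanishes. Nonnegativity is asked on this line only, so that the lemma also serves a form that is
  nonnegative merely on a subspace.\<close>

lemma form_zero_imp_kernel:
  assumes herm: "\<And>x y. cdot x (B *v y) = cdot (B *v x) y"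
    and zero: "Re (cdot x (B *v x)) = 0"
    and nonneg: "\<And>s. 0 \<le> Re (cdot (x + complex_of_real s *s (B *v x))
                                (B *v (x + complex_of_real s *s (B *v x))))"
  shows "B *v x = 0"
proof -
  let ?y = "B *v x"
  have "0 \<le> 2 * s * (norm ?y)\<^sup>2 + s\<^sup>2 * Re (cdot ?y (B *v ?y))" for s
  proof -
    have "cdot x (B *v ?y) = complex_of_real ((norm ?y)\<^sup>2)"
      using herm[of x ?y] by (simp only: cdot_self)
    then show ?thesis
      using nonneg[of s] zero
      by (simp add: matrix_vector_right_distrib vec.scale cdot_simps cdot_self
          power2_eq_square algebra_simps)
  qed
  then have "(norm ?y)\<^sup>2 = 0" by (rule quadratic_nonneg_imp_linear_zero)
  then show ?thesis by simp
qed

lemma psd_kernel: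
  assumes "psd A" and "Re (cdot x (A *v x)) = 0"
  shows "A *v x = 0"
  using form_zero_imp_kernel[of A x] psd_hermitian[OF assms(1)] assms by (simp add: psd_iff)

lemma psd_add: "psd A \<Longrightarrow> psd B \<Longrightarrow> psd (A + B)"
  by (simp add: psd_iff matrix_vector_mult_add_rdistrib cdot_simps)

lemma scaleR_mult_vec: "(c *\<^sub>R A) *v x = complex_of_real c *s (A *v x)"
  by (simp add: vec_eq_iff matrix_vector_mult_def sum_distrib_left
      scaleR_conv_of_real[where 'a = complex] mult.assoc)

lemma psd_scaleR: "psd A \<Longrightarrow> 0 \<le> c \<Longrightarrow> psd (c *\<^sub>R A)"
  by (simp add: psd_iff scaleR_mult_vec cdot_simps)

text \<open>Rayleigh quotient: the form of \<open>A\<close> attains its maximum \<open>q x\<close>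
  on the unit sphere of the invariant subspace \<open>W\<close>. Then
  \<open>B = q x *\<^sub>R mat 1 - A\<close> is nonnegative on \<open>W\<close> and its form
  vanishes at \<open>x\<close>, hence \<open>B *v x = 0\<close>.\<close>

lemma hermitian_eigenvector:
  fixes A :: "complex^'n^'n"
  assumes herm: "\<And>x y. cdot x (A *v y) = cdot (A *v x) y"
    and W: "closed W" "\<And>x y. x \<in> W \<Longrightarrow> y \<in> W \<Longrightarrow> x + y \<in> W"
      "\<And>c x. x \<in> W \<Longrightarrow> c *s x \<in> W" "\<And>x. x \<in> W \<Longrightarrow> A *v x \<in> W"
    and "z \<in> W" "z \<noteq> 0"
  shows "\<exists>x\<in>W. \<exists>l. norm x = 1 \<and> A *v x = complex_of_real l *s x"
proof -
  have scale_norm: "norm (complex_of_real c *s x) = \<bar>c\<bar> * norm x" for c and x :: "complex^'n"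
  proof -
    have "complex_of_real c *s x = c *\<^sub>R x"
      by (simp add: vec_eq_iff scaleR_conv_of_real[symmetric])
    then show ?thesis by simp
  qed
  let ?S = "W \<inter> sphere 0 1"
  define q where "q x = Re (cdot x (A *v x))" for x
  have normal: "complex_of_real (1 / norm y) *s y \<in> ?S" if "y \<in> W" "y \<noteq> 0" for y
    using that W(3) scale_norm[of "1 / norm y" y] by simp
  have "compact ?S"
    using W(1) by (simp add: closed_Int_compact)
  moreover have "?S \<noteq> {}" using normal \<open>z \<in> W\<close> \<open>z \<noteq> 0\<close> by blast
  moreover have "continuous_on ?S q"
    unfolding q_def by (intro continuous_intros)
  ultimately obtain x where x: "x \<in> ?S" and max: "\<And>y. y \<in> ?S \<Longrightarrow> q y \<le> q x"
    by (meson continuous_attains_sup)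
  define B where "B = q x *\<^sub>R mat 1 - A"
  have B: "B *v y = complex_of_real (q x) *s y - A *v y" for y
    by (simp add: B_def matrix_vector_mult_diff_rdistrib scaleR_mult_vec)
  have qB: "Re (cdot y (B *v y)) = q x * (norm y)\<^sup>2 - q y" for y
    by (simp add: B cdot_simps cdot_self q_def)
  have nonneg: "0 \<le> Re (cdot y (B *v y))" if "y \<in> W" for y
  proof (cases "y = 0")
    case True
    then show ?thesis by (simp add: cdot_def)
  next
    case False
    define c where "c = 1 / norm y"
    have "q (complex_of_real c *s y) = c\<^sup>2 * q y"
      by (simp add: q_def vec.scale cdot_simps power2_eq_square)
    moreover have "q (complex_of_real c *s y) \<le> q x"
      unfolding c_def using max normal[OF that False] by blast
    ultimately have "c\<^sup>2 * q y \<le> q x" by simp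
    then have "q y \<le> q x * (norm y)\<^sup>2"
      using False by (simp add: c_def field_simps)
    then show ?thesis by (simp add: qB)
  qed
  have Bx: "B *v x \<in> W"
  proof -
    have "complex_of_real (q x) *s x + (- 1) *s (A *v x) \<in> W"
      using x W by blast
    then show ?thesis by (simp add: B)
  qed
  have "B *v x = 0"
  proof (rule form_zero_imp_kernel)
    show "cdot u (B *v v) = cdot (B *v u) v" for u v
    proof -
      have "cdot (B *v u) v = cnj (cdot v (B *v u))" by (simp add: cdot_cnj)
      also have "\<dots> = cdot u (B *v v)"
        by (simp add: B cdot_simps cdot_cnj herm)
      finally show ?thesis ..
    qed
    show "Re (cdot x (B *v x)) = 0" using x by (simp add: qB)
    show "0 \<le> Re (cdot (x + complex_of_real s *s (B *v x))
                      (B *v (x + complex_of_real s *s (B *v x))))" for s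
      using x Bx W by (intro nonneg) auto
  qed
  then have "A *v x = complex_of_real (q x) *s x" by (simp add: B)
  then show ?thesis using x by auto
qed

text \<open>Induction on the index set: the next eigenvector is found in the orthogonal complement
  \<open>W\<close> of the previous ones, which is nonzero and, \<open>A\<close> being Hermitian,
  invariant. Indexing by subsets of the basis type makes the family for \<open>UNIV\<close> the
  columns of a square matrix.\<close>

lemma hermitian_orthonormal_eigenvectors:
  fixes A :: "complex^'n^'n" and I :: "'n set"
  assumes herm: "\<And>x y. cdot x (A *v y) = cdot (A *v x) y"
  shows "\<exists>f d. (\<forall>i\<in>I. A *v f i = complex_of_real (d i) *s f i)
    \<and> (\<forall>i\<in>I. \<forall>j\<in>I. cdot (f i) (f j) = (if i = j then 1 else 0))"
proof (induction I rule: finite_induct[OF finite])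
  case 1
  then show ?case by simp
next
  case (2 k I)
  then obtain f d where ev: "\<And>i. i \<in> I \<Longrightarrow> A *v f i = complex_of_real (d i) *s f i"
    and on: "\<And>i j. i \<in> I \<Longrightarrow> j \<in> I \<Longrightarrow> cdot (f i) (f j) = (if i = j then 1 else 0)"
    by blast
  define W where "W = {x. \<forall>i\<in>I. cdot (f i) x = 0}"
  \<comment> \<open>Row \<open>k\<close> of \<open>M\<close> vanishes, so \<open>M\<close> has a nontrivial kernel.\<close>
  define M :: "complex^'n^'n" where "M = (\<chi> i j. if i \<in> I then cnj (f i $ j) else 0)"
  have "\<nexists>B. B ** M = mat 1"
  proof
    assume "\<exists>B. B ** M = mat 1"
    then obtain B where "M ** B = mat 1" using matrix_left_right_inverse by blast
    then have "(M ** B) $ k $ k = 1" by (simp add: mat_def)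
    then show False using \<open>k \<notin> I\<close> by (simp add: matrix_matrix_mult_def M_def)
  qed
  then obtain z where z: "M *v z = 0" "z \<noteq> 0"
    using matrix_left_invertible_ker by blast
  have "cdot (f i) z = (M *v z) $ i" if "i \<in> I" for i
    using that by (simp add: cdot_def M_def matrix_vector_mult_def)
  then have "z \<in> W" using z(1) by (simp add: W_def)
  have "closed W"
  proof -
    have "W = (\<Inter>i\<in>I. {x. cdot (f i) x = 0})" by (auto simp: W_def)
    moreover have "closed {x. cdot (f i) x = 0}" for i
      by (intro closed_Collect_eq continuous_intros)
    ultimately show ?thesis by auto
  qed
  then obtain x l where x: "x \<in> W" "norm x = 1" "A *v x = complex_of_real l *s x"
    using hermitian_eigenvector[OF herm, of W z] \<open>z \<in> W\<close> z(2)
    by (auto simp: W_def cdot_simps herm ev)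
  have xf: "cdot x (f i) = 0" "cdot (f i) x = 0" if "i \<in> I" for i
  proof -
    show "cdot (f i) x = 0" using x(1) that by (simp add: W_def)
    then show "cdot x (f i) = 0" by (metis cdot_cnj complex_cnj_zero)
  qed
  have xx: "cdot x x = 1" by (simp add: cdot_self x(2))
  show ?case
    by (rule exI[of _ "f(k := x)"], rule exI[of _ "d(k := l)"])
      (use \<open>k \<notin> I\<close> ev on x xf xx in auto)
qed

lemma hermitian_diagonalization:
  fixes A :: "complex^'n^'n"
  assumes "\<And>x y. cdot x (A *v y) = cdot (A *v x) y"
  obtains U d where "unitary U" "A = U ** diag d ** adj U"
proof -
  obtain f :: "'n \<Rightarrow> complex^'n" and d where ev: "\<And>i. A *v f i = complex_of_real (d i) *s f i"
    and on: "\<And>i j. cdot (f i) (f j) = (if i = j then 1 else 0)"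
    using hermitian_orthonormal_eigenvectors[OF assms, of UNIV] by (metis UNIV_I)
  define U :: "complex^'n^'n" where "U = (\<chi> i j. f j $ i)"
  have "adj U ** U = mat 1"
    using on by (simp add: vec_eq_iff U_def adj_def matrix_matrix_mult_def mat_def cdot_def)
  then have U: "unitary U" using matrix_left_right_inverse by (auto simp: unitary_def)
  have "(A ** U) $ i $ j = (U ** diag d) $ i $ j" for i j
  proof -
    have "(A ** U) $ i $ j = (A *v f j) $ i"
      by (simp add: U_def matrix_matrix_mult_def matrix_vector_mult_def)
    then show ?thesis by (simp add: ev diag_mult_right U_def mult.commute)
  qed
  then have "A ** U = U ** diag d" by (simp add: vec_eq_iff)
  then have "A = U ** diag d ** adj U"
    by (metis U matrix_mul_assoc matrix_mul_rid unitary_def)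
  with U show ?thesis using that by blast
qed

lemma unitary_cancel:
  assumes "unitary U"
  shows "X ** U ** adj U = X" "X ** adj U ** U = X"
  using assms by (simp_all add: unitary_def flip: matrix_mul_assoc)

lemma cdot_diag: "cdot x (diag d *v x) = complex_of_real (\<Sum>i\<in>UNIV. d i * (cmod (x $ i))\<^sup>2)"
proof -
  have "(diag d *v x) $ i = complex_of_real (d i) * x $ i" for i
    by (simp add: matrix_vector_mult_def diag_def if_distrib[of "\<lambda>x. x * _"] cong: if_cong)
  then have "cdot x (diag d *v x) = (\<Sum>i\<in>UNIV. complex_of_real (d i) * (x $ i * cnj (x $ i)))"
    by (simp add: cdot_def algebra_simps)
  also have "\<dots> = complex_of_real (\<Sum>i\<in>UNIV. d i * (cmod (x $ i))\<^sup>2)"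
    by (simp flip: complex_norm_square)
  finally show ?thesis .
qed

lemma psd_conj_diag:
  assumes "\<And>i. 0 \<le> d i"
  shows "psd (U ** diag d ** adj U)"
proof -
  have "cdot x ((U ** diag d ** adj U) *v x) = cdot (adj U *v x) (diag d *v (adj U *v x))" for x
    by (simp add: cdot_adj[of x U] flip: matrix_vector_mul_assoc)
  then show ?thesis
    using assms by (simp add: psd_iff cdot_diag sum_nonneg)
qed

lemma psd_diagonalization:
  fixes A :: "complex^'n^'n"
  assumes "psd A"
  obtains U d where "unitary U" "A = U ** diag d ** adj U" "\<And>i. 0 \<le> d i"
proof -
  obtain U d where U: "unitary U" and A: "A = U ** diag d ** adj U"
    using hermitian_diagonalization psd_hermitian[OF assms] by blast
  have "0 \<le> d i" for i
  proof -
    \<comment> \<open>The eigenvalue \<open>d i\<close> is the value of the form at column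
      \<open>i\<close> of \<open>U\<close>.\<close>
    let ?e = "axis i 1 :: complex^'n"
    have "adj U *v (U *v ?e) = ?e"
      using U by (simp add: unitary_def matrix_vector_mul_assoc)
    then have "cdot (U *v ?e) (A *v (U *v ?e)) = cdot ?e (diag d *v ?e)"
      by (simp add: A cdot_adj[of _ U] flip: matrix_vector_mul_assoc)
    also have "\<dots> = complex_of_real (d i)"
      by (simp add: cdot_diag axis_def if_distrib[of "\<lambda>x. (cmod x)\<^sup>2"] if_distrib[of "\<lambda>x. _ * x"] cong: if_cong)
    finally show ?thesis using assms by (metis Re_complex_of_real psd_iff)
  qed
  with U A show ?thesis using that by blast
qed

section \<open>Joint convexity of the relative entropy\<close>

lemma trace_mult_diag_mult_diag:
  "trace (A ** diag p ** B ** diag q)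
    = (\<Sum>i\<in>UNIV. \<Sum>j\<in>UNIV. A $ j $ i * complex_of_real (p i) * B $ i $ j * complex_of_real (q j))"
proof -
  have "(A ** diag p ** B ** diag q) $ j $ j =
      (\<Sum>i\<in>UNIV. A $ j $ i * complex_of_real (p i) * B $ i $ j * complex_of_real (q j))" for j
    by (simp only: diag_mult_right) (simp add: matrix_matrix_mult_def[of "A ** diag p" B] diag_mult_right sum_distrib_right)
  then show ?thesis unfolding trace_def by simp (rule sum.swap)
qed

lemma trace_conj_unitary:
  assumes "unitary U"
  shows "trace (U ** A ** adj U) = trace A"
  using assms trace_mul_sym[of "U ** A" "adj U"]
  by (simp add: matrix_mul_assoc) (simp add: unitary_def)

lemma diag_1 [simp]: "diag (\<lambda>_. 1) = mat 1"
  by (simp add: diag_def mat_def vec_eq_iff)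

lemma diag_mult_diag: "diag p ** diag r = diag (\<lambda>i. p i * r i)"
  by (simp add: vec_eq_iff diag_mult_left) (simp add: diag_def)

lemma trace_diag: "trace (diag d) = complex_of_real (\<Sum>i\<in>UNIV. d i)"
  by (simp add: trace_def diag_def)

text \<open>The transition probability between column \<open>i\<close> of \<open>U\<close> and
  column \<open>j\<close> of \<open>V\<close>. These weights turn traces of two noncommuting
  matrices into double sums over their eigenvalues.\<close>

definition overlap :: "complex^'n^'n \<Rightarrow> complex^'n^'n \<Rightarrow> 'n \<Rightarrow> 'n \<Rightarrow> real" where
  "overlap U V i j = (cmod ((adj V ** U) $ j $ i))\<^sup>2"

lemma trace_mult_diagonalizations:
  assumes U: "unitary U" and V: "unitary V"
  shows "trace ((U ** diag p ** adj U) ** (V ** diag q ** adj V))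
    = complex_of_real (\<Sum>i\<in>UNIV. \<Sum>j\<in>UNIV. overlap U V i j * p i * q j)"
proof -
  define W where "W = adj V ** U"
  have "trace ((U ** diag p ** adj U) ** (V ** diag q ** adj V))
      = trace (V ** (W ** diag p ** adj W ** diag q) ** adj V)"
    by (simp add: W_def adj_mult matrix_mul_assoc unitary_cancel[OF V])
      (simp add: V[unfolded unitary_def])
  also have "\<dots> = trace (W ** diag p ** adj W ** diag q)"
    by (rule trace_conj_unitary[OF V])
  also have "\<dots> = (\<Sum>i\<in>UNIV. \<Sum>j\<in>UNIV.
      (W $ j $ i * cnj (W $ j $ i)) * complex_of_real (p i * q j))"
    by (simp add: trace_mult_diag_mult_diag) (simp add: adj_def algebra_simps)
  also have "\<dots> = complex_of_real (\<Sum>i\<in>UNIV. \<Sum>j\<in>UNIV. overlap U V i j * p i * q j)"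
    by (simp add: overlap_def W_def algebra_simps flip: complex_norm_square)
  finally show ?thesis .
qed

lemma trace_diagonalization:
  assumes "unitary U"
  shows "trace (U ** diag p ** adj U) = complex_of_real (\<Sum>i\<in>UNIV. p i)"
  by (simp add: trace_conj_unitary[OF assms] trace_diag)

text \<open>Spreads the trace over both indices, so that it can be merged termwise with the double
  sums for two matrices.\<close>

lemma trace_diagonalization_overlap:
  assumes "unitary U" "unitary V"
  shows "trace (U ** diag p ** adj U) = complex_of_real (\<Sum>i\<in>UNIV. \<Sum>j\<in>UNIV. overlap U V i j * p i)"
  using trace_mult_diagonalizations[OF assms, of p "\<lambda>_. 1"] assms(2)
  by (simp add: unitary_def)

text \<open>Always a real number. For positive matrices it is the usual relative entropy when the
  kernel of \<open>\<sigma>\<close> lies in that of \<open>\<rho>\<close>; the lemmas on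
  subadditivity assume this inclusion.\<close>

definition relative_entropy :: "complex^'n^'n \<Rightarrow> complex^'n^'n \<Rightarrow> real" where
  "relative_entropy \<rho> \<sigma> = Re (trace (\<rho> ** hfun ln \<rho>)) - Re (trace (\<rho> ** hfun ln \<sigma>))"

text \<open>Up to the convention at zero eigenvalues, this is the classical relative entropy of the
  weights \<open>overlap U V i j * p i\<close> and \<open>overlap U V i j * q j\<close>.\<close>

lemma relative_entropy_diagonalization:
  assumes U: "unitary U" and V: "unitary V"
  shows "relative_entropy (U ** diag p ** adj U) (V ** diag q ** adj V)
    = (\<Sum>i\<in>UNIV. \<Sum>j\<in>UNIV. overlap U V i j * p i * (ln (p i) - ln (q j)))"
proof -
  have "trace ((U ** diag p ** adj U) ** hfun ln (U ** diag p ** adj U))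
      = trace (U ** diag (\<lambda>i. p i * ln (p i)) ** adj U)"
    by (simp add: hfun_diagonalization[OF U] matrix_mul_assoc unitary_cancel[OF U])
      (simp add: diag_mult_diag flip: matrix_mul_assoc)
  then show ?thesis
    by (simp add: relative_entropy_def trace_diagonalization_overlap[OF U V]
        hfun_diagonalization[OF V] trace_mult_diagonalizations[OF U V]
        algebra_simps sum_subtractf)
qed

text \<open>
  Writing \<open>L\<^sub>\<sigma>\<close> and \<open>R\<^sub>\<rho>\<close> for left and right multiplication, the supremum of this form over \<open>Y\<close> is
  \<open>\<langle>\<rho>, (L\<^sub>\<sigma> + t R\<^sub>\<rho>)\<^sup>-\<^sup>1 \<rho>\<rangle>\<close>. The form is linear in \<open>(\<rho>, \<sigma>)\<close>, so the supremum is subadditive.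
\<close>

definition variational_form where
  "variational_form t Y \<rho> \<sigma> = 2 * Re (trace (adj Y ** \<rho>)) - Re (trace (adj Y ** \<sigma> ** Y))
      - t * Re (trace (Y ** \<rho> ** adj Y))"

lemma matrix_mult_add_rdistrib: "(B + C) ** A = B ** A + C ** (A :: complex^'n^'m)"
  by (simp add: matrix_matrix_mult_def vec_eq_iff algebra_simps sum.distrib)

lemma variational_form_add:
  "variational_form t Y (\<rho> + \<rho>') (\<sigma> + \<sigma>') = variational_form t Y \<rho> \<sigma> + variational_form t Y \<rho>' \<sigma>'"
  by (simp add: variational_form_def matrix_add_ldistrib matrix_mult_add_rdistrib trace_add algebra_simps)

lemma trace_mult_diag:
  "trace (A ** B ** diag p) = (\<Sum>i\<in>UNIV. \<Sum>j\<in>UNIV. A $ i $ j * B $ j $ i * complex_of_real (p i))"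
  unfolding trace_def diag_mult_right by (simp add: matrix_matrix_mult_def sum_distrib_right)

text \<open>In these coordinates left multiplication by \<open>\<sigma>\<close> and right
  multiplication by \<open>\<rho>\<close> are both diagonal, so the form splits into independent
  quadratics, one for each entry of \<open>Z\<close>, which can be maximized separately.\<close>

lemma variational_form_diagonalization:
  assumes U: "unitary U" and V: "unitary V"
  shows "variational_form t (V ** Z ** adj U) (U ** diag p ** adj U) (V ** diag q ** adj V)
    = (\<Sum>i\<in>UNIV. \<Sum>j\<in>UNIV. 2 * Re (cnj (Z $ j $ i) * (adj V ** U) $ j $ i) * p i
        - (q j + t * p i) * (cmod (Z $ j $ i))\<^sup>2)"
proof -
  have norm: "z * (c * cnj z) = c * complex_of_real ((cmod z)\<^sup>2)"
    "cnj z * (c * z) = c * complex_of_real ((cmod z)\<^sup>2)" for z c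
    by (simp_all add: complex_norm_square algebra_simps del: of_real_power)
  let ?Y = "V ** Z ** adj U"
  have "trace (adj ?Y ** (U ** diag p ** adj U)) = trace (U ** (adj Z ** (adj V ** U) ** diag p) ** adj U)"
    by (simp add: adj_mult matrix_mul_assoc unitary_cancel[OF U])
  then have 1: "Re (trace (adj ?Y ** (U ** diag p ** adj U)))
      = (\<Sum>i\<in>UNIV. \<Sum>j\<in>UNIV. Re (cnj (Z $ j $ i) * (adj V ** U) $ j $ i) * p i)"
    by (simp only: trace_conj_unitary[OF U] trace_mult_diag Re_sum) (simp add: adj_def)
  have "trace (adj ?Y ** (V ** diag q ** adj V) ** ?Y) = trace (U ** (adj Z ** diag q ** Z ** diag (\<lambda>_. 1)) ** adj U)"
    by (simp add: adj_mult matrix_mul_assoc unitary_cancel[OF V])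
  then have "trace (adj ?Y ** (V ** diag q ** adj V) ** ?Y)
      = (\<Sum>j\<in>UNIV. \<Sum>i\<in>UNIV. complex_of_real (q j * (cmod (Z $ j $ i))\<^sup>2))"
    by (simp only: trace_conj_unitary[OF U] trace_mult_diag_mult_diag) (simp add: adj_def norm mult.assoc)
  then have 2: "Re (trace (adj ?Y ** (V ** diag q ** adj V) ** ?Y))
      = (\<Sum>i\<in>UNIV. \<Sum>j\<in>UNIV. q j * (cmod (Z $ j $ i))\<^sup>2)"
    by (simp only: Re_sum Re_complex_of_real) (rule sum.swap)
  have "trace (?Y ** (U ** diag p ** adj U) ** adj ?Y) = trace (V ** (Z ** diag p ** adj Z ** diag (\<lambda>_. 1)) ** adj V)"
    by (simp add: adj_mult matrix_mul_assoc unitary_cancel[OF U])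
  then have 3: "Re (trace (?Y ** (U ** diag p ** adj U) ** adj ?Y))
      = (\<Sum>i\<in>UNIV. \<Sum>j\<in>UNIV. p i * (cmod (Z $ j $ i))\<^sup>2)"
    by (simp only: trace_conj_unitary[OF V] trace_mult_diag_mult_diag) (simp add: adj_def norm mult.assoc flip: of_real_power)
  show ?thesis
    unfolding variational_form_def 1 2 3
    by (simp only: sum_distrib_left sum_subtractf[symmetric]) (simp add: algebra_simps)
qed

text \<open>Completing the square in \<open>z\<close>; the second part names the maximizer. For
  \<open>c = 0\<close> the assumption removes the linear term, and division by zero makes the
  right-hand side and the maximizer 0.\<close>

lemma complete_square_complex:
  fixes z w :: complex and c p :: real
  assumes "0 \<le> c" and "c = 0 \<Longrightarrow> w = 0 \<or> p = 0"
  shows "2 * Re (cnj z * w) * p - c * (cmod z)\<^sup>2 \<le> (cmod w)\<^sup>2 * p\<^sup>2 / c"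
    and "z = w * complex_of_real (p / c) \<Longrightarrow>
      2 * Re (cnj z * w) * p - c * (cmod z)\<^sup>2 = (cmod w)\<^sup>2 * p\<^sup>2 / c"
proof -
  have *: "c * ((cmod w)\<^sup>2 * p\<^sup>2 / c - (2 * Re (cnj z * w) * p - c * (cmod z)\<^sup>2))
      = (cmod (complex_of_real c * z - complex_of_real p * w))\<^sup>2" if "c > 0"
    using that by (simp add: cmod_power2) (simp add: power2_eq_square field_simps)
  show "2 * Re (cnj z * w) * p - c * (cmod z)\<^sup>2 \<le> (cmod w)\<^sup>2 * p\<^sup>2 / c"
  proof (cases "c = 0")
    case False
    with assms(1) have "c > 0" by simp
    with * have "0 \<le> c * ((cmod w)\<^sup>2 * p\<^sup>2 / c - (2 * Re (cnj z * w) * p - c * (cmod z)\<^sup>2))"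
      by simp
    then show ?thesis using \<open>c > 0\<close> by (simp only: zero_le_mult_iff) simp
  qed (use assms(2) in auto)
  assume z: "z = w * complex_of_real (p / c)"
  show "2 * Re (cnj z * w) * p - c * (cmod z)\<^sup>2 = (cmod w)\<^sup>2 * p\<^sup>2 / c"
  proof (cases "c = 0")
    case False
    have "Re (cnj z * w) = (cmod w)\<^sup>2 * (p / c)"
      by (simp add: z cmod_power2) (simp add: power2_eq_square add_divide_distrib algebra_simps)
    moreover have "(cmod z)\<^sup>2 = (cmod w)\<^sup>2 * (p / c)\<^sup>2"
      by (simp add: z norm_mult norm_divide power_mult_distrib power_divide)
    ultimately have "2 * Re (cnj z * w) * p - c * (cmod z)\<^sup>2
        = 2 * ((cmod w)\<^sup>2 * (p / c)) * p - c * ((cmod w)\<^sup>2 * (p / c)\<^sup>2)"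
      by (simp only:)
    then show ?thesis using False by (simp add: field_simps power2_eq_square)
  qed (use assms z in auto)
qed

lemma tendsto_ln_affine_minus_ln:
  fixes p q :: real
  assumes "0 < p"
  shows "((\<lambda>T. ln (q + T * p) - ln T) \<longlongrightarrow> ln p) at_top"
proof -
  have "((\<lambda>T. ln (q * inverse T + p)) \<longlongrightarrow> ln (q * 0 + p)) at_top"
    using assms by (intro tendsto_intros tendsto_inverse_0_at_top filterlim_ident) auto
  moreover have "eventually (\<lambda>T. 0 < q + T * p) at_top"
    using eventually_gt_at_top[of "- q / p"] by eventually_elim (use assms in \<open>simp add: field_simps\<close>)
  then have "eventually (\<lambda>T. ln (q * inverse T + p) = ln (q + T * p) - ln T) at_top"
    using eventually_gt_at_top[of 0]
  proof eventually_elim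
    case (elim T)
    then have "q * inverse T + p = (q + T * p) / T" by (simp add: field_simps)
    with elim show ?case by (simp add: ln_div)
  qed
  ultimately show ?thesis by (simp add: filterlim_cong)
qed

text \<open>The integral representation of the relative entropy, integrated only up to \<open>T\<close> so that it is
  a finite sum of logarithms: \<open>\<Phi> T\<close> is the integral over \<open>[0, T]\<close> of the suprema \<open>F t\<close>.\<close>

lemma relative_entropy_variational:
  fixes \<rho> \<sigma> :: "complex^'n^'n"
  assumes "psd \<rho>" "psd \<sigma>" and ker: "\<And>x. \<sigma> *v x = 0 \<Longrightarrow> \<rho> *v x = 0"
  obtains \<Phi> F where "\<Phi> 0 = (0::real)"
    and "\<And>t. 0 \<le> t \<Longrightarrow> (\<Phi> has_real_derivative F t) (at t)"
    and "\<And>t Y. 0 \<le> t \<Longrightarrow> variational_form t Y \<rho> \<sigma> \<le> F t"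
    and "\<And>t. 0 \<le> t \<Longrightarrow> \<exists>Y. variational_form t Y \<rho> \<sigma> = F t"
    and "((\<lambda>T. \<Phi> T - Re (trace \<rho>) * ln T) \<longlongrightarrow> relative_entropy \<rho> \<sigma>) at_top"
proof -
  obtain U p where U: "unitary U" and \<rho>: "\<rho> = U ** diag p ** adj U" and p: "\<And>i. 0 \<le> p i"
    using psd_diagonalization[OF assms(1)] by blast
  obtain V q where V: "unitary V" and \<sigma>: "\<sigma> = V ** diag q ** adj V" and q: "\<And>i. 0 \<le> q i"
    using psd_diagonalization[OF assms(2)] by blast
  define w where "w = overlap U V"
  \<comment> \<open>If \<open>q j = 0\<close>, column \<open>j\<close> of \<open>V\<close> lies in
    the kernel of \<open>\<sigma>\<close>, hence in that of \<open>\<rho>\<close>, and so is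
    orthogonal to every eigenvector of \<open>\<rho>\<close> with nonzero eigenvalue. Thus every
    nonzero term below has \<open>p i\<close> and \<open>q j\<close> positive.\<close>
  have W0: "(adj V ** U) $ j $ i = 0 \<or> p i = 0" if "q j = 0" for i j
  proof -
    have col: "(A *v axis j 1) $ k = A $ k $ j" for A :: "complex^'n^'n" and k
      by (simp add: matrix_vector_mult_def axis_def if_distrib[of "\<lambda>x. _ * x"] cong: if_cong)
    have "\<sigma> *v (V *v axis j 1) = V *v (diag q *v axis j 1)"
      using V by (simp add: \<sigma> matrix_vector_mul_assoc unitary_cancel)
    also have "diag q *v axis j 1 = 0"
      using that by (simp only: vec_eq_iff col) (simp add: diag_def)
    finally have "\<rho> *v (V *v axis j 1) = 0" by (intro ker) simp
    then have "adj U *v (\<rho> *v (V *v axis j 1)) = 0" by simp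
    then have "(diag p ** (adj U ** V)) *v axis j 1 = 0"
      using U by (simp add: \<rho> matrix_vector_mul_assoc matrix_mul_assoc unitary_def)
    then have "(diag p ** (adj U ** V)) $ i $ j = 0"
      using col by (metis zero_index)
    moreover have "(adj U ** V) $ i $ j = cnj ((adj V ** U) $ j $ i)"
      using arg_cong[OF adj_mult[of "adj V" U], of "\<lambda>A. A $ i $ j"] by (simp add: adj_def[of "adj V ** U"])
    ultimately show ?thesis by (auto simp: diag_mult_left)
  qed
  have w0: "w i j * p i = 0 \<or> (0 < p i \<and> 0 < q j)" for i j
    using W0[of j i] p[of i] q[of j] by (auto simp: w_def overlap_def less_le)
  \<comment> \<open>\<open>F\<close> sums the maxima found by completing the squares, and
    \<open>\<Phi>\<close> is its termwise antiderivative that vanishes at 0.\<close>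
  define \<Phi> where "\<Phi> T = (\<Sum>i\<in>UNIV. \<Sum>j\<in>UNIV. w i j * p i * (ln (q j + T * p i) - ln (q j)))" for T
  define F where "F t = (\<Sum>i\<in>UNIV. \<Sum>j\<in>UNIV. w i j * (p i)\<^sup>2 / (q j + t * p i))" for t
  have "\<Phi> 0 = 0" by (simp add: \<Phi>_def)
  moreover have "(\<Phi> has_real_derivative F t) (at t)" if "0 \<le> t" for t
  proof -
    have "((\<lambda>T. w i j * p i * (ln (q j + T * p i) - ln (q j))) has_real_derivative
        w i j * (p i)\<^sup>2 / (q j + t * p i)) (at t)" for i j
    proof (cases "w i j * p i = 0")
      case False
      then have "0 < p i" "0 < q j" using w0 by blast+
      then have "0 < q j + t * p i" using that by (simp add: add_pos_nonneg)
      then show ?thesis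
        by (auto intro!: derivative_eq_intros simp: power2_eq_square)
    next
      case True
      then show ?thesis by (auto simp: power2_eq_square)
    qed
    then show ?thesis
      unfolding \<Phi>_def[abs_def] F_def by (intro DERIV_sum)
  qed
  moreover have "variational_form t Y \<rho> \<sigma> \<le> F t" if "0 \<le> t" for t Y
  proof -
    \<comment> \<open>Every \<open>Y\<close> has the form required by the coordinate formula, so the
      entrywise bounds apply to it.\<close>
    have Y: "Y = V ** (adj V ** Y ** U) ** adj U"
      using V by (simp add: matrix_mul_assoc unitary_cancel[OF U]) (simp add: unitary_def)
    show ?thesis
      unfolding \<rho> \<sigma> F_def w_def overlap_def
      by (subst Y, subst variational_form_diagonalization[OF U V], intro sum_mono complete_square_complex(1))
        (use p q that W0 in \<open>auto simp: add_nonneg_eq_0_iff\<close>)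
  qed
  moreover have "\<exists>Y. variational_form t Y \<rho> \<sigma> = F t" if "0 \<le> t" for t
  proof -
    \<comment> \<open>The entrywise maximizer from \<open>complete_square_complex\<close>, with
      \<open>c = q j + t * p i\<close>.\<close>
    define Z where "Z = (\<chi> j i. (adj V ** U) $ j $ i * complex_of_real (p i / (q j + t * p i)))"
    have "variational_form t (V ** Z ** adj U) \<rho> \<sigma> = F t"
      unfolding \<rho> \<sigma> F_def w_def overlap_def
      by (subst variational_form_diagonalization[OF U V], intro sum.cong refl complete_square_complex(2))
        (use p q that W0 in \<open>auto simp: add_nonneg_eq_0_iff Z_def\<close>)
    then show ?thesis by blast
  qed
  moreover have "((\<lambda>T. \<Phi> T - Re (trace \<rho>) * ln T) \<longlongrightarrow> relative_entropy \<rho> \<sigma>) at_top"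
  proof -
    \<comment> \<open>The weights \<open>w i j * p i\<close> add up to the trace of
      \<open>\<rho>\<close>, so the divergent \<open>Re (trace \<rho>) * ln T\<close> can be
      distributed as one \<open>ln T\<close> per term, leaving \<open>ln (p i) - ln (q j)\<close> in
      the limit.\<close>
    have "((\<lambda>T. w i j * p i * ((ln (q j + T * p i) - ln T) - ln (q j))) \<longlongrightarrow>
        w i j * p i * (ln (p i) - ln (q j))) at_top" for i j
    proof (cases "w i j * p i = 0")
      case False
      then have "0 < p i" using w0 by blast
      then show ?thesis by (intro tendsto_intros tendsto_ln_affine_minus_ln)
    qed auto
    then have "((\<lambda>T. \<Sum>i\<in>UNIV. \<Sum>j\<in>UNIV. w i j * p i * ((ln (q j + T * p i) - ln T) - ln (q j))) \<longlongrightarrow>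
        (\<Sum>i\<in>UNIV. \<Sum>j\<in>UNIV. w i j * p i * (ln (p i) - ln (q j)))) at_top"
      by (intro tendsto_sum)
    moreover have "\<Phi> T - Re (trace \<rho>) * ln T
        = (\<Sum>i\<in>UNIV. \<Sum>j\<in>UNIV. w i j * p i * ((ln (q j + T * p i) - ln T) - ln (q j)))" for T
    proof -
      have "Re (trace \<rho>) = (\<Sum>i\<in>UNIV. \<Sum>j\<in>UNIV. w i j * p i)"
        unfolding \<rho> w_def trace_diagonalization_overlap[OF U V] by simp
      then show ?thesis
        by (simp only: \<Phi>_def sum_distrib_right sum_subtractf[symmetric]) (simp add: algebra_simps)
    qed
    moreover have "relative_entropy \<rho> \<sigma> = (\<Sum>i\<in>UNIV. \<Sum>j\<in>UNIV. w i j * p i * (ln (p i) - ln (q j)))"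
      unfolding \<rho> \<sigma> w_def by (rule relative_entropy_diagonalization[OF U V])
    ultimately show ?thesis by (simp only:)
  qed
  ultimately show ?thesis by (rule that)
qed

text \<open>A maximizer \<open>Y\<close> for the sums is a competitor for both summands, hence
  \<open>F \<le> F1 + F2\<close>. Integrating gives the same for the truncated integrals; the terms
  in \<open>ln T\<close> cancel because the trace is additive, and \<open>T\<close> tends to
  infinity.\<close>

lemma relative_entropy_subadditive:
  fixes \<rho> \<rho>' \<sigma> \<sigma>' :: "complex^'n^'n"
  assumes "psd \<rho>" "psd \<sigma>" and ker: "\<And>x. \<sigma> *v x = 0 \<Longrightarrow> \<rho> *v x = 0"
    and "psd \<rho>'" "psd \<sigma>'" and ker': "\<And>x. \<sigma>' *v x = 0 \<Longrightarrow> \<rho>' *v x = 0"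
  shows "relative_entropy (\<rho> + \<rho>') (\<sigma> + \<sigma>') \<le> relative_entropy \<rho> \<sigma> + relative_entropy \<rho>' \<sigma>'"
proof -
  obtain \<Phi>1 F1 where 1: "\<Phi>1 0 = (0::real)"
    "\<And>t. 0 \<le> t \<Longrightarrow> (\<Phi>1 has_real_derivative F1 t) (at t)"
    "\<And>t Y. 0 \<le> t \<Longrightarrow> variational_form t Y \<rho> \<sigma> \<le> F1 t"
    "((\<lambda>T. \<Phi>1 T - Re (trace \<rho>) * ln T) \<longlongrightarrow> relative_entropy \<rho> \<sigma>) at_top"
    by (rule relative_entropy_variational[OF assms(1-3)]) (assumption, rule that)
  obtain \<Phi>2 F2 where 2: "\<Phi>2 0 = (0::real)"
    "\<And>t. 0 \<le> t \<Longrightarrow> (\<Phi>2 has_real_derivative F2 t) (at t)"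
    "\<And>t Y. 0 \<le> t \<Longrightarrow> variational_form t Y \<rho>' \<sigma>' \<le> F2 t"
    "((\<lambda>T. \<Phi>2 T - Re (trace \<rho>') * ln T) \<longlongrightarrow> relative_entropy \<rho>' \<sigma>') at_top"
    by (rule relative_entropy_variational[OF assms(4-6)]) (assumption, rule that)
  \<comment> \<open>Two nonnegative forms with sum zero at \<open>x\<close> both vanish there, so
    the kernel of the sum lies in both kernels.\<close>
  have ker_sum: "(\<rho> + \<rho>') *v x = 0" if "(\<sigma> + \<sigma>') *v x = 0" for x
  proof -
    have "Re (cdot x (\<sigma> *v x)) + Re (cdot x (\<sigma>' *v x)) = Re (cdot x ((\<sigma> + \<sigma>') *v x))"
      by (simp add: matrix_vector_mult_add_rdistrib cdot_simps)
    also have "\<dots> = 0" using that by (simp add: cdot_def)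
    finally have "Re (cdot x (\<sigma> *v x)) = 0" "Re (cdot x (\<sigma>' *v x)) = 0"
      using assms(2,5) by (auto simp: psd_iff add_nonneg_eq_0_iff)
    then show ?thesis
      using psd_kernel[OF assms(2)] psd_kernel[OF assms(5)] ker ker'
      by (simp add: matrix_vector_mult_add_rdistrib)
  qed
  obtain \<Phi> F where 0: "\<Phi> 0 = (0::real)"
    "\<And>t. 0 \<le> t \<Longrightarrow> (\<Phi> has_real_derivative F t) (at t)"
    "\<And>t. 0 \<le> t \<Longrightarrow> \<exists>Y. variational_form t Y (\<rho> + \<rho>') (\<sigma> + \<sigma>') = F t"
    "((\<lambda>T. \<Phi> T - Re (trace (\<rho> + \<rho>')) * ln T) \<longlongrightarrow> relative_entropy (\<rho> + \<rho>') (\<sigma> + \<sigma>')) at_top"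
    by (rule relative_entropy_variational[OF psd_add[OF assms(1,4)] psd_add[OF assms(2,5)] ker_sum])
      (assumption, rule that)
  have F: "F t \<le> F1 t + F2 t" if t: "0 \<le> t" for t
  proof -
    obtain Y where "variational_form t Y (\<rho> + \<rho>') (\<sigma> + \<sigma>') = F t"
      using 0(3)[OF t] by blast
    then show ?thesis
      using 1(3)[OF t, of Y] 2(3)[OF t, of Y] by (simp add: variational_form_add)
  qed
  have le: "\<Phi> T \<le> \<Phi>1 T + \<Phi>2 T" if "0 \<le> T" for T
  proof -
    \<comment> \<open>The integrals are compared through derivatives: the difference vanishes at 0
      and is nondecreasing.\<close>
    have "\<Phi>1 0 + \<Phi>2 0 - \<Phi> 0 \<le> \<Phi>1 T + \<Phi>2 T - \<Phi> T"
    proof (rule DERIV_nonneg_imp_nondecreasing[OF that], intro exI conjI)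
      fix t :: real assume "0 \<le> t" "t \<le> T"
      then show "((\<lambda>T. \<Phi>1 T + \<Phi>2 T - \<Phi> T) has_real_derivative F1 t + F2 t - F t) (at t)"
        by (intro derivative_intros 0 1 2)
      show "0 \<le> F1 t + F2 t - F t" using F[OF \<open>0 \<le> t\<close>] by simp
    qed
    then show ?thesis using 0(1) 1(1) 2(1) by simp
  qed
  show ?thesis
  proof (rule tendsto_le[OF _ tendsto_add[OF 1(4) 2(4)] 0(4)])
    show "eventually (\<lambda>T. \<Phi> T - Re (trace (\<rho> + \<rho>')) * ln T
        \<le> (\<Phi>1 T - Re (trace \<rho>) * ln T) + (\<Phi>2 T - Re (trace \<rho>') * ln T)) at_top"
      using eventually_ge_at_top[of 0]
      by eventually_elim (use le in \<open>simp add: trace_add algebra_simps\<close>)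
  qed simp
qed

section \<open>Entropy inequalities\<close>

lemma hfun_ln_scaled_mat_1: "hfun ln (c *\<^sub>R mat 1) = ln c *\<^sub>R (mat 1 :: complex^'n^'n)"
proof -
  have "c *\<^sub>R mat 1 = diag (\<lambda>_. c)" for c
    by (simp add: vec_eq_iff mat_def diag_def scaleR_conv_of_real[where 'a = complex])
  then have "c *\<^sub>R mat 1 = mat 1 ** diag (\<lambda>_. c) ** adj (mat 1 :: complex^'n^'n)" for c
    by simp
  moreover have "unitary (mat 1 :: complex^'n^'n)"
    by (simp add: unitary_def)
  ultimately show ?thesis
    by (simp only: hfun_diagonalization)
qed

lemma relative_entropy_scaled_mat_1:
  "relative_entropy X (c *\<^sub>R mat 1) = - entropy X - Re (trace X) * ln c"
proof -
  have "X ** (c *\<^sub>R mat 1) = c *\<^sub>R X" for c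
    by (simp add: vec_eq_iff matrix_matrix_mult_def mat_def if_distrib[of "\<lambda>x. _ * x"]
        if_distrib[of "\<lambda>x. _ *\<^sub>R x"] scaleR_conv_of_real[where 'a = complex] mult.commute cong: if_cong)
  then show ?thesis
    by (simp add: relative_entropy_def entropy_def hfun_ln_scaled_mat_1 trace_def
        sum_distrib_left mult.commute)
qed

text \<open>The relative entropies of \<open>X\<close> and of \<open>Y\<close> to
  \<open>X + Y\<close> are both nonpositive, and their sum is
  \<open>entropy (X + Y) - entropy X - entropy Y\<close>.\<close>

lemma entropy_subadditive:
  assumes "psd X" "psd Y"
  shows "entropy (X + Y) \<le> entropy X + entropy Y"
proof -
  have "psd 0" by (simp add: psd_iff cdot_def)
  have zero: "relative_entropy Z Z = 0" "relative_entropy 0 Z = 0" for Z :: "complex^'a^'a"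
    by (simp_all add: relative_entropy_def matrix_matrix_mult_def trace_def)
  have "relative_entropy X (X + Y) \<le> 0"
    using relative_entropy_subadditive[of X X 0 Y] assms \<open>psd 0\<close> by (simp add: zero)
  moreover have "relative_entropy Y (X + Y) \<le> 0"
    using relative_entropy_subadditive[of 0 X Y Y] assms \<open>psd 0\<close> by (simp add: zero)
  ultimately show ?thesis
    by (simp add: relative_entropy_def entropy_def matrix_mult_add_rdistrib trace_add)
qed

lemma psd_trace_zero:
  assumes "psd X" "Re (trace X) = 0"
  shows "X = 0"
proof -
  obtain U d where U: "unitary U" and X: "X = U ** diag d ** adj U" and d: "\<And>i. 0 \<le> d i"
    using psd_diagonalization[OF assms(1)] by blast
  have "(\<Sum>i\<in>UNIV. d i) = 0"
    using assms(2) by (simp add: X trace_diagonalization[OF U])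
  then have "d i = 0" for i
    using d by (simp add: sum_nonneg_eq_0_iff)
  then have "diag d = 0" by (simp add: diag_def vec_eq_iff)
  then show ?thesis by (simp add: X matrix_matrix_mult_def vec_eq_iff)
qed

lemma psd_trace_nonneg:
  assumes "psd X"
  shows "0 \<le> Re (trace X)"
  using psd_diagonalization[OF assms] trace_diagonalization
  by (metis Re_complex_of_real sum_nonneg)

text \<open>Concavity for unnormalized matrices: the logarithmic terms account for the
  normalization, and for \<open>x + y = 1\<close> they add up to
  \<open>- binary_entropy x\<close>.\<close>

lemma entropy_concave:
  assumes "psd X" "psd Y"
  defines "x \<equiv> Re (trace X)" and "y \<equiv> Re (trace Y)"
  shows "entropy X + entropy Y + x * ln x + y * ln y - (x + y) * ln (x + y) \<le> entropy (X + Y)"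
proof -
  have psd_id: "psd (c *\<^sub>R mat 1 :: complex^'a^'a)" if "0 \<le> c" for c
    using that by (intro psd_scaleR) (auto simp: psd_iff cdot_self)
  \<comment> \<open>At trace zero the reference matrix is 0 and its kernel is the whole space, so
    the inclusion of kernels rests on \<open>Z = 0\<close>.\<close>
  have ker: "Z *v v = 0" if "psd Z" "(Re (trace Z) *\<^sub>R mat 1) *v v = 0" for Z and v :: "complex^'a"
  proof (cases "Re (trace Z) = 0")
    case True
    then show ?thesis using psd_trace_zero[OF that(1)] by simp
  next
    case False
    then show ?thesis using that(2) by (simp add: scaleR_mult_vec)
  qed
  have "relative_entropy (X + Y) (x *\<^sub>R mat 1 + y *\<^sub>R mat 1)
      \<le> relative_entropy X (x *\<^sub>R mat 1) + relative_entropy Y (y *\<^sub>R mat 1)"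
    unfolding x_def y_def
    by (rule relative_entropy_subadditive[OF assms(1) psd_id[OF psd_trace_nonneg] ker
          assms(2) psd_id[OF psd_trace_nonneg] ker]) (use assms in auto)
  then show ?thesis
    by (simp add: relative_entropy_scaled_mat_1 trace_add x_def y_def flip: scaleR_add_left)
qed

section \<open>Conditional entropy\<close>

definition id_tensor :: "complex^'b^'b \<Rightarrow> complex^('a::finite \<times> 'b::finite)^('a \<times> 'b)" where
  "id_tensor N = (\<chi> r s. if fst r = fst s then N $ snd r $ snd s else 0)"

definition basis_tensor :: "'a \<Rightarrow> complex^'b \<Rightarrow> complex^('a::finite \<times> 'b::finite)" where
  "basis_tensor a y = (\<chi> r. if fst r = a then y $ snd r else 0)"

lemma sum_UNIV_prod: "(\<Sum>r\<in>UNIV. f r) = (\<Sum>a\<in>UNIV. \<Sum>b\<in>UNIV. f (a, b))"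
  by (simp add: sum.cartesian_product flip: UNIV_Times_UNIV)

lemma sum_if_const:
  "(\<Sum>b\<in>UNIV. if P then f b else (0 :: 'a :: comm_monoid_add)) = (if P then \<Sum>b\<in>UNIV. f b else 0)"
  by simp

lemma id_tensor_mult: "id_tensor (M ** N) = id_tensor M ** id_tensor N"
  by (auto simp: vec_eq_iff id_tensor_def matrix_matrix_mult_def sum_UNIV_prod
      if_distrib[of "\<lambda>x. x * _"] if_distrib[of "\<lambda>x. _ * x"] sum_if_const cong: if_cong)

lemma id_tensor_adj: "id_tensor (adj M) = adj (id_tensor M)"
  by (auto simp: vec_eq_iff id_tensor_def adj_def)

lemma id_tensor_mat_1: "id_tensor (mat 1) = mat 1"
  by (auto simp: vec_eq_iff id_tensor_def mat_def)

lemma id_tensor_add: "id_tensor (M + N) = id_tensor M + id_tensor N"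
  by (auto simp: vec_eq_iff id_tensor_def)

lemma id_tensor_diag: "id_tensor (diag d) = diag (\<lambda>r. d (snd r))"
  by (auto simp: vec_eq_iff id_tensor_def diag_def)

lemma unitary_id_tensor: "unitary U \<Longrightarrow> unitary (id_tensor U)"
  unfolding unitary_def by (metis id_tensor_adj id_tensor_mat_1 id_tensor_mult)

text \<open>Tensoring with the identity only repeats the eigenvalues; functional calculus and
  positivity of \<open>id_tensor\<close> follow from this form.\<close>

lemma id_tensor_diagonalization:
  "id_tensor (U ** diag d ** adj U) = id_tensor U ** diag (\<lambda>r. d (snd r)) ** adj (id_tensor U)"
  by (simp add: id_tensor_mult id_tensor_adj id_tensor_diag)

lemma hfun_id_tensor:
  assumes "psd N"
  shows "hfun f (id_tensor N) = id_tensor (hfun f N)"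
proof -
  obtain U d where U: "unitary U" and N: "N = U ** diag d ** adj U"
    using psd_diagonalization[OF assms] by blast
  show ?thesis
    by (simp add: N id_tensor_diagonalization hfun_diagonalization unitary_id_tensor U)
qed

lemma psd_id_tensor:
  assumes "psd N"
  shows "psd (id_tensor N)"
proof -
  obtain U d where U: "unitary U" and N: "N = U ** diag d ** adj U" and d: "\<And>i. 0 \<le> d i"
    using psd_diagonalization[OF assms] by blast
  show ?thesis
    unfolding N id_tensor_diagonalization using d by (intro psd_conj_diag)
qed

text \<open>Duality of \<open>id_tensor\<close> and the partial trace under the trace pairing; it
  turns a trace on the marginal into one on the full space.\<close>

lemma trace_mult_id_tensor: "trace (M ** id_tensor N) = trace (partial_trace_A M ** N)"
proof -
  have "trace (M ** id_tensor N) = (\<Sum>a\<in>UNIV. \<Sum>b\<in>UNIV. \<Sum>c\<in>UNIV. M $ (a, b) $ (a, c) * N $ c $ b)"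
    by (simp add: trace_def matrix_matrix_mult_def sum_UNIV_prod id_tensor_def
        if_distrib[of "\<lambda>x. _ * x"] sum_if_const cong: if_cong)
  also have "\<dots> = (\<Sum>b\<in>UNIV. \<Sum>a\<in>UNIV. \<Sum>c\<in>UNIV. M $ (a, b) $ (a, c) * N $ c $ b)"
    by (rule sum.swap)
  also have "\<dots> = (\<Sum>b\<in>UNIV. \<Sum>c\<in>UNIV. \<Sum>a\<in>UNIV. M $ (a, b) $ (a, c) * N $ c $ b)"
    by (intro sum.cong refl sum.swap)
  also have "\<dots> = trace (partial_trace_A M ** N)"
    by (simp add: trace_def matrix_matrix_mult_def partial_trace_A_def sum_distrib_right)
  finally show ?thesis .
qed

lemma trace_partial_trace_A: "trace (partial_trace_A M) = trace M"
  using trace_mult_id_tensor[of M "mat 1"] by (simp add: id_tensor_mat_1)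

lemma partial_trace_A_add: "partial_trace_A (M + N) = partial_trace_A M + partial_trace_A N"
  by (simp add: partial_trace_A_def vec_eq_iff sum.distrib)

lemma partial_trace_A_scaleR: "partial_trace_A (c *\<^sub>R M) = c *\<^sub>R partial_trace_A M"
  by (simp add: partial_trace_A_def vec_eq_iff scaleR_sum_right)

text \<open>The form of the marginal is a sum of values of the form of \<open>M\<close> at product
  vectors, so positivity passes to the marginal.\<close>

lemma cdot_partial_trace_A:
  fixes M :: "complex^('a::finite \<times> 'b::finite)^('a \<times> 'b)"
  shows "cdot y (partial_trace_A M *v y) = (\<Sum>a\<in>UNIV. cdot (basis_tensor a y) (M *v basis_tensor a y))"
proof -
  have "(\<Sum>a\<in>UNIV. cdot (basis_tensor a y) (M *v basis_tensor a y))
      = (\<Sum>a\<in>UNIV. \<Sum>b\<in>UNIV. \<Sum>c\<in>UNIV. cnj (y $ b) * (M $ (a, b) $ (a, c) * y $ c))"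
  proof (intro sum.cong refl)
    fix a :: 'a
    have "(M *v basis_tensor a y) $ r = (\<Sum>c\<in>UNIV. M $ r $ (a, c) * y $ c)" for r
      by (simp add: matrix_vector_mult_def basis_tensor_def sum_UNIV_prod
          if_distrib[of "\<lambda>x. _ * x"] sum_if_const cong: if_cong)
    then show "cdot (basis_tensor a y) (M *v basis_tensor a y)
        = (\<Sum>b\<in>UNIV. \<Sum>c\<in>UNIV. cnj (y $ b) * (M $ (a, b) $ (a, c) * y $ c))"
      by (simp add: cdot_def basis_tensor_def sum_UNIV_prod if_distrib[of cnj]
          if_distrib[of "\<lambda>x. x * _"] sum_if_const sum_distrib_left cong: if_cong)
  qed
  also have "\<dots> = (\<Sum>b\<in>UNIV. \<Sum>a\<in>UNIV. \<Sum>c\<in>UNIV. cnj (y $ b) * (M $ (a, b) $ (a, c) * y $ c))"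
    by (rule sum.swap)
  also have "\<dots> = (\<Sum>b\<in>UNIV. \<Sum>c\<in>UNIV. \<Sum>a\<in>UNIV. cnj (y $ b) * (M $ (a, b) $ (a, c) * y $ c))"
    by (intro sum.cong refl sum.swap)
  also have "\<dots> = cdot y (partial_trace_A M *v y)"
    by (simp add: cdot_def matrix_vector_mult_def partial_trace_A_def sum_distrib_right sum_distrib_left)
  finally show ?thesis ..
qed

lemma psd_partial_trace_A: "psd M \<Longrightarrow> psd (partial_trace_A M)"
  by (simp add: psd_iff cdot_partial_trace_A sum_nonneg)

text \<open>The support of \<open>M\<close> lies in the full first factor tensored with the support
  of the marginal. Each slice of \<open>x\<close> is in the kernel of the marginal; the form there
  is a sum of nonnegative values of the form of \<open>M\<close>, so each of them vanishes, and
  \<open>x\<close> is a sum of the corresponding product vectors.\<close>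

lemma kernel_id_tensor_partial_trace_A:
  assumes "psd M" "id_tensor (partial_trace_A M) *v x = 0"
  shows "M *v x = 0"
proof -
  define slice where "slice a = (\<chi> b. x $ (a, b))" for a
  have "M *v basis_tensor a (slice a) = 0" for a
  proof -
    have "(partial_trace_A M *v slice a) $ b = (id_tensor (partial_trace_A M) *v x) $ (a, b)" for b
      by (simp add: slice_def matrix_vector_mult_def id_tensor_def sum_UNIV_prod
          if_distrib[of "\<lambda>x. x * _"] sum_if_const cong: if_cong)
    then have "partial_trace_A M *v slice a = 0"
      using assms(2) by (simp add: vec_eq_iff)
    then have "cdot (slice a) (partial_trace_A M *v slice a) = 0"
      by (simp add: cdot_def)
    then have "(\<Sum>k\<in>UNIV. Re (cdot (basis_tensor k (slice a)) (M *v basis_tensor k (slice a)))) = 0"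
      by (simp add: cdot_partial_trace_A flip: Re_sum)
    then have "Re (cdot (basis_tensor a (slice a)) (M *v basis_tensor a (slice a))) = 0"
      using assms(1) by (subst (asm) sum_nonneg_eq_0_iff) (auto simp: psd_iff)
    then show ?thesis by (rule psd_kernel[OF assms(1)])
  qed
  moreover have "x = (\<Sum>a\<in>UNIV. basis_tensor a (slice a))"
    by (auto simp: vec_eq_iff slice_def basis_tensor_def)
  ultimately show ?thesis
    by (metis (no_types, lifting) sum.neutral vec.sum)
qed

lemma relative_entropy_id_tensor_partial_trace_A:
  assumes "psd M"
  shows "relative_entropy M (id_tensor (partial_trace_A M)) = - cond_entropy M"
  by (simp add: relative_entropy_def cond_entropy_def entropy_def trace_mult_id_tensor
      hfun_id_tensor[OF psd_partial_trace_A[OF assms]])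

lemma cond_entropy_superadditive:
  assumes "psd M" "psd N"
  shows "cond_entropy M + cond_entropy N \<le> cond_entropy (M + N)"
proof -
  have "relative_entropy (M + N) (id_tensor (partial_trace_A M) + id_tensor (partial_trace_A N))
      \<le> relative_entropy M (id_tensor (partial_trace_A M)) + relative_entropy N (id_tensor (partial_trace_A N))"
    by (intro relative_entropy_subadditive assms psd_id_tensor psd_partial_trace_A)
      (auto intro: kernel_id_tensor_partial_trace_A assms)
  then show ?thesis
    using assms by (simp add: relative_entropy_id_tensor_partial_trace_A psd_add
        flip: id_tensor_add partial_trace_A_add)
qed

section \<open>Homogeneity and the final inequality\<close>

lemma entropy_scaleR:
  assumes "psd X" "0 \<le> c"
  shows "entropy (c *\<^sub>R X) = c * entropy X - c * ln c * Re (trace X)"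
proof -
  obtain U d where U: "unitary U" and X: "X = U ** diag d ** adj U" and d: "\<And>i. 0 \<le> d i"
    using psd_diagonalization[OF assms(1)] by blast
  have ent: "entropy (U ** diag e ** adj U) = - (\<Sum>i\<in>UNIV. e i * ln (e i))" for e
  proof -
    have "U ** diag e ** adj U ** hfun ln (U ** diag e ** adj U) = U ** diag (\<lambda>i. e i * ln (e i)) ** adj U"
      by (simp add: hfun_diagonalization[OF U] matrix_mul_assoc unitary_cancel[OF U])
        (simp add: diag_mult_diag flip: matrix_mul_assoc)
    then show ?thesis by (simp add: entropy_def trace_diagonalization[OF U])
  qed
  have "U ** diag (\<lambda>i. c * d i) = c *\<^sub>R (U ** diag d)"
    by (simp add: vec_eq_iff diag_mult_right scaleR_conv_of_real[where 'a = complex] algebra_simps)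
  then have "c *\<^sub>R X = U ** diag (\<lambda>i. c * d i) ** adj U"
    by (simp add: X vec_eq_iff matrix_matrix_mult_def[of _ "adj U"] scaleR_sum_right)
  \<comment> \<open>The logarithm of the product splits only for positive factors; if one is 0, both
    sides vanish.\<close>
  moreover have "c * d i * ln (c * d i) = c * (d i * ln (d i)) + c * ln c * d i" for i
    using d[of i] assms(2) by (cases "c = 0"; cases "d i = 0") (auto simp: ln_mult algebra_simps)
  ultimately show ?thesis
    by (simp add: ent X trace_diagonalization[OF U] sum.distrib sum_distrib_left algebra_simps)
qed

text \<open>The corrections \<open>c * ln c * Re (trace X)\<close> of the two entropies cancel,
  since \<open>M\<close> and its marginal have equal trace.\<close>

lemma cond_entropy_scaleR:
  assumes "psd M" "0 \<le> c"
  shows "cond_entropy (c *\<^sub>R M) = c * cond_entropy M"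
  using assms by (simp add: cond_entropy_def partial_trace_A_scaleR entropy_scaleR
      psd_partial_trace_A trace_partial_trace_A algebra_simps)

theorem theorem2:
  fixes \<rho>\<^sub>1 \<rho>\<^sub>2 \<rho>\<^sub>p \<rho>\<^sub>m K :: "complex^('a::finite \<times> 'b::finite)^('a \<times> 'b)"
    and \<epsilon> :: real
  assumes "density_matrix \<rho>\<^sub>1" and "density_matrix \<rho>\<^sub>2"
    and "0 \<le> \<epsilon>" and "\<epsilon> \<le> 1"
    and "1 / 2 * trace_norm (\<rho>\<^sub>1 - \<rho>\<^sub>2) = \<epsilon>"
    and "density_matrix \<rho>\<^sub>p" and "density_matrix \<rho>\<^sub>m"
    and "orthogonal_supports \<rho>\<^sub>p \<rho>\<^sub>m"
    and "\<rho>\<^sub>1 - \<rho>\<^sub>2 = \<epsilon> *\<^sub>R \<rho>\<^sub>p - \<epsilon> *\<^sub>R \<rho>\<^sub>m"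
    and "K = \<rho>\<^sub>1 - \<epsilon> *\<^sub>R \<rho>\<^sub>p"
    and "psd K"
  shows "cond_entropy \<rho>\<^sub>1 - cond_entropy \<rho>\<^sub>2
    \<le> \<epsilon> * cond_entropy \<rho>\<^sub>p - \<epsilon> * cond_entropy \<rho>\<^sub>m + binary_entropy \<epsilon>"
proof -
  let ?P = "\<epsilon> *\<^sub>R \<rho>\<^sub>p" and ?M = "\<epsilon> *\<^sub>R \<rho>\<^sub>m"
  have p: "psd \<rho>\<^sub>p" "trace \<rho>\<^sub>p = 1" and m: "psd \<rho>\<^sub>m"
    using assms(6,7) by (simp_all add: density_matrix_def)
  have P: "psd ?P" and M: "psd ?M"
    using p m assms(3) by (auto intro: psd_scaleR)
  have \<rho>\<^sub>1: "\<rho>\<^sub>1 = K + ?P" and \<rho>\<^sub>2: "\<rho>\<^sub>2 = K + ?M"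
    using assms(9,10) by (auto simp: algebra_simps)
  have trP: "Re (trace ?P) = \<epsilon>"
    using p(2) by (simp add: trace_def flip: scaleR_sum_right)
  moreover have "trace \<rho>\<^sub>1 = 1"
    using assms(1) by (simp add: density_matrix_def)
  ultimately have trK: "Re (trace K) = 1 - \<epsilon>"
    by (simp add: assms(10) trace_sub)
  \<comment> \<open>The marginals of \<open>K\<close> and \<open>?P\<close> have traces
    \<open>1 - \<epsilon>\<close> and \<open>\<epsilon>\<close>, so the logarithmic terms of
    \<open>entropy_concave\<close> are exactly \<open>- binary_entropy \<epsilon>\<close>.\<close>
  have "entropy (partial_trace_A K) + entropy (partial_trace_A ?P) - binary_entropy \<epsilon>
      \<le> entropy (partial_trace_A \<rho>\<^sub>1)"
    using entropy_concave[OF psd_partial_trace_A[OF assms(11)] psd_partial_trace_A[OF P]]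
    by (simp add: trace_partial_trace_A trK trP \<rho>\<^sub>1 partial_trace_A_add binary_entropy_def)
  moreover have "entropy \<rho>\<^sub>1 \<le> entropy K + entropy ?P"
    unfolding \<rho>\<^sub>1 by (rule entropy_subadditive[OF assms(11) P])
  moreover have "cond_entropy K + cond_entropy ?M \<le> cond_entropy \<rho>\<^sub>2"
    unfolding \<rho>\<^sub>2 by (rule cond_entropy_superadditive[OF assms(11) M])
  \<comment> \<open>The first two bounds give \<open>cond_entropy \<rho>\<^sub>1 \<le> cond_entropy
    K + cond_entropy ?P + binary_entropy \<epsilon>\<close>; \<open>cond_entropy K\<close> cancels
    against the third.\<close>
  ultimately have "cond_entropy \<rho>\<^sub>1 - cond_entropy \<rho>\<^sub>2 \<le> cond_entropy ?P - cond_entropy ?M + binary_entropy \<epsilon>"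
    by (simp add: cond_entropy_def)
  then show ?thesis
    by (simp add: cond_entropy_scaleR p m assms(3))
qed

end
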